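(* For every purely inseparable extension $K/k$, one has $di(K/k)\le di(k)$.
   Context: All fields are commutative of characteristic $p>0$. A subset $B\subseteq K$ is an $r$-base of an extension $K/k$ if $K=k(K^p)(B)$ and, for every $x\in B$, $x\notin k(K^p)(B\setminus\{x\})$; every extension has an $r$-base and all $r$-bases of a given extension have the same cardinality. For a purely inseparable extension $K/k$ and $n\ge 1$, put $k_n=k^{p^{-n}}\cap K=\{x\in K: x^{p^n}\in k\}$ and let $B_n$ be an $r$-base of $k_n/k$. The degree of irrationality of $K/k$ is the cardinal $di(K/k)=\sup_{n\ge 1}|B_n|$ (supremum of cardinals). The degree of imperfection $di(k)$ of the field $k$ is the cardinality of an $r$-base of $k/k^p$ (a $p$-base of $k$). *)

theory Defs
  imports "HOL-Algebra.Generated_Fields"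
begin

unbundle cardinal_syntax

section \<open>Suprema of cardinals\<close>

text \<open>
  Cardinals are represented, as in the library, by well-orders \<open>r\<close> with \<open>Card_order r\<close>,
  considered up to \<open>=o\<close> and compared by \<open>\<le>o\<close>.
\<close>

definition is_card_sup :: "'a rel set \<Rightarrow> 'a rel \<Rightarrow> bool" where
  "is_card_sup A s \<longleftrightarrow>
     Card_order s \<and> (\<forall>r\<in>A. r \<le>o s) \<and>
     (\<forall>t :: 'a rel. Card_order t \<and> (\<forall>r\<in>A. r \<le>o t) \<longrightarrow> s \<le>o t)"

definition card_sup :: "'a rel set \<Rightarrow> 'a rel" where
  "card_sup A = (SOME s. is_card_sup A s)"

text \<open>
  The supremum exists, and although \<open>is_card_sup\<close> only quantifies over
  cardinals living on \<^typ>\<open>'a\<close>, it is least among the upper bounds on any type.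
\<close>

lemma is_card_sup_card_sup:
  fixes A :: "'a rel set"
  assumes "\<And>r. r \<in> A \<Longrightarrow> Card_order r"
  shows "is_card_sup A (card_sup A)"
proof -
  let ?U = "{t :: 'a rel. Card_order t \<and> (\<forall>r\<in>A. r \<le>o t)}"
  have "r \<le>o |UNIV :: 'a set|" if "r \<in> A" for r
    using ordIso_ordLeq_trans[OF ordIso_symmetric[OF card_of_Field_ordIso[OF assms[OF that]]]
        card_of_mono1[OF subset_UNIV]] .
  then have "?U \<noteq> {}"
    using card_of_Card_order[of "UNIV :: 'a set"] by blast
  then obtain s where "s \<in> ?U" "\<forall>t\<in>?U. s \<le>o t"
    using exists_minim_Card_order[of ?U] by blast
  then have "is_card_sup A s"
    unfolding is_card_sup_def by blast
  then show ?thesis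
    unfolding card_sup_def by (rule someI)
qed

lemma card_sup_least:
  fixes A :: "'a rel set" and t :: "'b rel"
  assumes "\<And>r. r \<in> A \<Longrightarrow> Card_order r" and t: "Card_order t" "\<And>r. r \<in> A \<Longrightarrow> r \<le>o t"
  shows "card_sup A \<le>o t"
proof -
  have sup: "is_card_sup A (card_sup A)"
    using assms(1) by (rule is_card_sup_card_sup)
  then have s: "Card_order (card_sup A)"
    by (simp add: is_card_sup_def)
  show ?thesis
  proof (rule ccontr)
    assume "\<not> card_sup A \<le>o t"
    then have lt: "t <o card_sup A"
      using not_ordLeq_iff_ordLess[OF card_order_on_well_order_on[OF t(1)]
          card_order_on_well_order_on[OF s]] by blast
    have "|Field t| \<le>o |Field (card_sup A)|"
      by (rule card_of_mono2[OF ordLess_imp_ordLeq[OF lt]])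
    then obtain f where f: "inj_on f (Field t)" "f ` Field t \<subseteq> Field (card_sup A)"
      unfolding card_of_ordLeq[symmetric] by blast
    have "|Field t| =o |f ` Field t|"
      by (rule card_of_ordIsoI[OF inj_on_imp_bij_betw[OF f(1)]])
    then have t': "|f ` Field t| =o t"
      by (rule ordIso_transitive[OF ordIso_symmetric card_of_Field_ordIso[OF t(1)]])
    have "\<forall>r\<in>A. r \<le>o |f ` Field t|"
      using ordLeq_ordIso_trans[OF t(2) ordIso_symmetric[OF t']] by blast
    then have "card_sup A \<le>o |f ` Field t|"
      using sup card_of_Card_order[of "f ` Field t"] by (simp add: is_card_sup_def)
    then have "card_sup A \<le>o t"
      by (rule ordLeq_ordIso_trans[OF _ t'])
    with \<open>\<not> card_sup A \<le>o t\<close> show False ..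
  qed
qed

section \<open>Extensions of fields of positive characteristic\<close>

text \<open>
  An extension \<open>K/k\<close> is a field record \<open>K\<close> together with a subfield \<open>k \<subseteq> carrier K\<close>;
  an intermediate set \<open>L\<close> is turned into a field by \<open>K\<lparr>carrier := L\<rparr>\<close>.
\<close>

text \<open>\<open>group.ord\<close> is \<open>0\<close> for elements of infinite order.\<close>

definition characteristic :: "('a, 'b) ring_scheme \<Rightarrow> nat" where
  "characteristic K = group.ord (add_monoid K) \<one>\<^bsub>K\<^esub>"

definition pth_powers :: "('a, 'b) ring_scheme \<Rightarrow> 'a set" where
  "pth_powers K = (\<lambda>x. x [^]\<^bsub>K\<^esub> characteristic K) ` carrier K"

definition r_base :: "('a, 'b) ring_scheme \<Rightarrow> 'a set \<Rightarrow> 'a set \<Rightarrow> bool" where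
  "r_base K k B \<longleftrightarrow>
     B \<subseteq> carrier K \<and>
     carrier K = generate_field K (k \<union> pth_powers K \<union> B) \<and>
     (\<forall>x\<in>B. x \<notin> generate_field K (k \<union> pth_powers K \<union> (B - {x})))"

text \<open>Every extension has an \<open>r\<close>-base and all of them have the same cardinality.\<close>

definition r_base_card :: "('a, 'b) ring_scheme \<Rightarrow> 'a set \<Rightarrow> 'a rel" where
  "r_base_card K k = |SOME B. r_base K k B|"

definition purely_inseparable :: "('a, 'b) ring_scheme \<Rightarrow> 'a set \<Rightarrow> bool" where
  "purely_inseparable K k \<longleftrightarrow>
     (\<forall>x\<in>carrier K. \<exists>n::nat. x [^]\<^bsub>K\<^esub> (characteristic K ^ n) \<in> k)"

definition root_level :: "('a, 'b) ring_scheme \<Rightarrow> 'a set \<Rightarrow> nat \<Rightarrow> 'a set" where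
  "root_level K k n = {x \<in> carrier K. x [^]\<^bsub>K\<^esub> (characteristic K ^ n) \<in> k}"

definition irrationality_degree :: "('a, 'b) ring_scheme \<Rightarrow> 'a set \<Rightarrow> 'a rel" where
  "irrationality_degree K k =
     card_sup ((\<lambda>n. r_base_card (K\<lparr>carrier := root_level K k n\<rparr>) k) ` {1..})"

definition imperfection_degree :: "('a, 'b) ring_scheme \<Rightarrow> 'a rel" where
  "imperfection_degree F = r_base_card F (pth_powers F)"

end

theory Submission
  imports
    Defs
    "HOL-Algebra.Finite_Extensions"
    "HOL-Algebra.Free_Abelian_Groups"
    "HOL-Computational_Algebra.Primes"
begin

text \<open>
  It suffices to bound each \<open>r\<close>-base \<open>B\<close> of \<open>L/k\<close>, where \<open>L\<close> is one of the fields \<open>k\<^sub>n\<close>, by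
  a \<open>p\<close>-base \<open>C\<close> of \<open>k\<close>. Write \<open>L\<^sub>m\<close> for the field of \<open>p\<^sup>m\<close>-th powers of elements of
  \<open>L\<close>. Three facts connect the two bases: \<open>L\<^sub>n \<subseteq> k\<close>; the set \<open>B\<close> is \<open>p\<close>-independent in
  \<open>L\<close>, being independent even over \<open>k(L\<^sub>1)\<close>; and iterating \<open>k = k\<^sup>p(C)\<close> gives
  \<open>k \<subseteq> L\<^sub>m(C)\<close> for every \<open>m\<close>.

  The comparison counts degrees over \<open>L\<^sub>m\<close>. Adjoining a \<open>p\<close>-th root that is not already
  present has degree exactly \<open>p\<close> (\<open>dimension_adjoin_pth_root\<close>). Hence, for a finite set \<open>S\<close>,
  the degree of \<open>L\<^sub>m(S)\<close> over \<open>L\<^sub>m\<close> is a power of \<open>p\<close> with exponent at most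
  \<open>m * card S\<close>, with equality if \<open>S\<close> is \<open>p\<close>-independent (\<open>dimension_adjoin_level\<close>). For a
  finite \<open>S \<subseteq> B\<close> the \<open>n\<close>-th power of the Frobenius map carries \<open>L\<^sub>m(S)\<close> into
  \<open>L\<^sub>m\<^sub>+\<^sub>n(F)\<close> for some finite \<open>F \<subseteq> C\<close>, so that \<open>m * card S \<le> (m + n) * card F\<close>
  (\<open>p_independent_card_bound\<close>). For finite \<open>C\<close>, taking \<open>F = C\<close> and \<open>m\<close> large yields
  \<open>card S \<le> card C\<close>. For infinite \<open>C\<close>, already \<open>m = 1\<close> shows that each finite \<open>F \<subseteq> C\<close>
  accounts for finitely many elements of \<open>B\<close>, so \<open>|B| \<le>o |C|\<close> (\<open>p_independent_ordLeq\<close>).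

  Cardinalities of \<open>r\<close>-bases are defined by choice, so their existence has to be proved as well
  (\<open>ex_r_base\<close>): it follows from Zorn's lemma and an exchange property, which is again the
  statement that simple extensions by \<open>p\<close>-th roots have degree \<open>1\<close> or \<open>p\<close>.
\<close>

section \<open>The Frobenius identity\<close>

lemma (in cring) binomial_finsum:
  assumes a: "a \<in> carrier R" and b: "b \<in> carrier R"
  shows "(a \<oplus> b) [^] n = (\<Oplus>k\<in>{..n}. [(n choose k)] \<cdot> (a [^] k \<otimes> b [^] (n - k)))"
proof (induction n)
  case 0
  show ?case using a b by simp
next
  case (Suc n)
  define t where "t n k = [(n choose k)] \<cdot> (a [^] k \<otimes> b [^] (n - k))" for n k :: nat
  have t: "t n k \<in> carrier R" for n k
    using a b by (simp add: t_def binomial_eq_0)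
  have step: "t (Suc n) (Suc k) = a \<otimes> t n k \<oplus> b \<otimes> t n (Suc k)" if "k \<le> n" for k
  proof -
    have "b \<otimes> t n (Suc k) = [(n choose Suc k)] \<cdot> (a [^] Suc k \<otimes> b [^] (n - k))"
    proof (cases "k = n")
      case False
      with that have "n - k = Suc (n - Suc k)" by simp
      then show ?thesis
        unfolding t_def using a b by (simp add: add_pow_rdistr m_ac)
    qed (use a b in \<open>simp add: t_def binomial_eq_0\<close>)
    moreover have "a \<otimes> t n k = [(n choose k)] \<cdot> (a [^] Suc k \<otimes> b [^] (n - k))"
      unfolding t_def using a b by (simp add: add_pow_rdistr m_ac)
    ultimately show ?thesis
      unfolding t_def using a b by (simp add: add.nat_pow_mult)
  qed
  have t0: "t (Suc n) 0 = b \<otimes> t n 0"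
    unfolding t_def using a b by (simp add: m_comm)
  \<comment> \<open>The summand of index \<open>n + 1\<close> vanishes, so both sums below may run over the same range.\<close>
  have last: "t n (Suc n) = \<zero>"
    using a b by (simp add: t_def binomial_eq_0)
  have "(a \<oplus> b) [^] Suc n = (a \<oplus> b) \<otimes> (\<Oplus>k\<in>{..n}. t n k)"
    using Suc a b by (simp add: t_def m_comm)
  also have "\<dots> = (\<Oplus>k\<in>{..n}. a \<otimes> t n k) \<oplus> (\<Oplus>k\<in>{..n}. b \<otimes> t n k)"
    using a b t by (simp add: l_distr finsum_rdistr finsum_closed Pi_def)
  also have "(\<Oplus>k\<in>{..n}. b \<otimes> t n k) = (\<Oplus>k\<in>{..Suc n}. b \<otimes> t n k)"
    using b t last by (simp add: Pi_def finsum_closed)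
  also have "\<dots> = (\<Oplus>k\<in>{..n}. b \<otimes> t n (Suc k)) \<oplus> b \<otimes> t n 0"
    using b t by (intro finsum_Suc2) (auto simp: Pi_def)
  also have "(\<Oplus>k\<in>{..n}. a \<otimes> t n k) \<oplus> \<dots> =
      (\<Oplus>k\<in>{..n}. a \<otimes> t n k \<oplus> b \<otimes> t n (Suc k)) \<oplus> t (Suc n) 0"
    using a b t by (simp add: finsum_addf Pi_def a_assoc finsum_closed t0)
  also have "(\<Oplus>k\<in>{..n}. a \<otimes> t n k \<oplus> b \<otimes> t n (Suc k)) = (\<Oplus>k\<in>{..n}. t (Suc n) (Suc k))"
    using t step by (intro finsum_cong') auto
  also have "\<dots> \<oplus> t (Suc n) 0 = (\<Oplus>k\<in>{..Suc n}. t (Suc n) k)"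
    using t by (intro finsum_Suc2[symmetric]) auto
  finally show ?case
    by (simp only: t_def)
qed

text \<open>
  The identity is stated for commutative rings because it is needed in the field itself and
  also for \<open>(X - x)\<^sup>p\<close> in its polynomial ring.
\<close>

lemma (in cring) frobenius_add:
  assumes p: "Factorial_Ring.prime p" "[p] \<cdot> \<one> = \<zero>" and a: "a \<in> carrier R" and b: "b \<in> carrier R"
  shows "(a \<oplus> b) [^] p = a [^] p \<oplus> b [^] (p::nat)"
proof -
  define t where "t k = [(p choose k)] \<cdot> (a [^] k \<otimes> b [^] (p - k))" for k :: nat
  have p0: "[p] \<cdot> x = \<zero>" if "x \<in> carrier R" for x
    using add_pow_ldistr[of \<one> x p] p(2) that by simp
  obtain q where q: "p = Suc (Suc q)"
    using prime_ge_2_nat[OF p(1)] by (metis add_2_eq_Suc le_Suc_ex)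
  have mid: "t k = \<zero>" if k: "0 < k" "k < p" for k
  proof -
    obtain c where c: "p choose k = p * c"
      using dvd_choose_prime[of k p] k p(1) by (auto elim: dvdE)
    show ?thesis
      unfolding t_def c using a b p0 add.nat_pow_pow[of "a [^] k \<otimes> b [^] (p - k)" p c]
      by (simp add: mult.commute)
  qed
  have t: "t k \<in> carrier R" for k
    using a b by (simp add: t_def binomial_eq_0)
  have "(a \<oplus> b) [^] p = (\<Oplus>k\<in>{..Suc (Suc q)}. t k)"
    using binomial_finsum[OF a b, of p] by (simp add: t_def q)
  also have "\<dots> = t p \<oplus> (\<Oplus>k\<in>{..Suc q}. t k)"
    unfolding q by (rule finsum_Suc) (use t in auto)
  also have "(\<Oplus>k\<in>{..Suc q}. t k) = (\<Oplus>k\<in>{..q}. t (Suc k)) \<oplus> t 0"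
    by (rule finsum_Suc2) (use t in auto)
  also have "(\<Oplus>k\<in>{..q}. t (Suc k)) = (\<Oplus>k\<in>{..q}. \<zero>)"
    using mid q by (intro finsum_cong') auto
  finally show ?thesis
    using a b by (simp add: t_def binomial_eq_0)
qed

section \<open>Adjoining a \<open>p\<close>-th root\<close>

text \<open>
  Induction on \<open>m\<close>: the root \<open>x\<close> of the product is a root of one of the factors, and the
  corresponding linear factor cancels.
\<close>

lemma (in domain) linear_power_factor:
  assumes x: "x \<in> carrier R"
    and "f \<in> carrier (poly_ring R)" "g \<in> carrier (poly_ring R)"
    and "f \<otimes>\<^bsub>poly_ring R\<^esub> g = [\<one>, \<ominus> x] [^]\<^bsub>poly_ring R\<^esub> (m::nat)"
  shows "\<exists>u\<in>Units (poly_ring R). \<exists>i. f = u \<otimes>\<^bsub>poly_ring R\<^esub> ([\<one>, \<ominus> x] [^]\<^bsub>poly_ring R\<^esub> (i::nat))"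
  using assms(2-4)
proof (induction m arbitrary: f g)
  interpret P: domain "poly_ring R"
    by (rule univ_poly_is_domain[OF carrier_is_subring])
  case 0
  then have "f \<otimes>\<^bsub>poly_ring R\<^esub> g = \<one>\<^bsub>poly_ring R\<^esub>"
    by simp
  then have "f \<in> Units (poly_ring R)"
    using P.m_comm[of f g] "0.prems" by (auto simp: Units_def intro!: bexI[of _ g])
  then have "f \<in> Units (poly_ring R) \<and> f = f \<otimes>\<^bsub>poly_ring R\<^esub> ([\<one>, \<ominus> x] [^]\<^bsub>poly_ring R\<^esub> (0::nat))"
    using 0 by simp
  then show ?case by blast
next
  interpret P: domain "poly_ring R"
    by (rule univ_poly_is_domain[OF carrier_is_subring])
  let ?P = "poly_ring R" and ?l = "[\<one>, \<ominus> x]"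
  case (Suc m)
  have l: "?l \<in> carrier ?P"
    using x by (simp add: univ_poly_carrier[symmetric] polynomial_def)
  then have lm: "?l [^]\<^bsub>?P\<^esub> k \<in> carrier ?P" for k :: nat
    by simp
  have "?l [^]\<^bsub>?P\<^esub> Suc m \<noteq> []"
    by (rule polynomial_pow_not_zero[OF l]) simp
  moreover have "eval (?l [^]\<^bsub>?P\<^esub> Suc m) x = \<zero>"
  proof -
    interpret E: ring_hom_ring ?P R "\<lambda>q. eval q x"
      by (rule eval_ring_hom[OF carrier_is_subring x])
    show ?thesis
      using l lm x by (simp add: r_neg)
  qed
  ultimately have "is_root (f \<otimes>\<^bsub>?P\<^esub> g) x"
    using x Suc.prems by (simp add: is_root_def)
  then consider "is_root f x" | "is_root g x"
    using is_root_poly_mult_imp_is_root Suc.prems by blast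
  then show ?case
  proof cases
    case 1
    then obtain f' where f': "f' \<in> carrier ?P" "f = ?l \<otimes>\<^bsub>?P\<^esub> f'"
      using is_root_imp_pdivides[OF Suc.prems(1)] unfolding pdivides_def factor_def by blast
    have "?l \<otimes>\<^bsub>?P\<^esub> (f' \<otimes>\<^bsub>?P\<^esub> g) = ?l \<otimes>\<^bsub>?P\<^esub> (?l [^]\<^bsub>?P\<^esub> m)"
      using Suc.prems f' l lm by (simp add: P.m_ac)
    then have "f' \<otimes>\<^bsub>?P\<^esub> g = ?l [^]\<^bsub>?P\<^esub> m"
      using P.m_lcancel[of ?l] l lm f' Suc.prems by (simp add: univ_poly_zero)
    from Suc.IH[OF f'(1) Suc.prems(2) this]
    obtain u i where ui: "u \<in> Units ?P" "f' = u \<otimes>\<^bsub>?P\<^esub> (?l [^]\<^bsub>?P\<^esub> (i::nat))"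
      by blast
    then have "f = u \<otimes>\<^bsub>?P\<^esub> (?l [^]\<^bsub>?P\<^esub> Suc i)"
      using f' l lm P.Units_closed by (simp add: P.m_ac)
    with ui show ?thesis by blast
  next
    case 2
    then obtain g' where g': "g' \<in> carrier ?P" "g = ?l \<otimes>\<^bsub>?P\<^esub> g'"
      using is_root_imp_pdivides[OF Suc.prems(2)] unfolding pdivides_def factor_def by blast
    have "?l \<otimes>\<^bsub>?P\<^esub> (f \<otimes>\<^bsub>?P\<^esub> g') = ?l \<otimes>\<^bsub>?P\<^esub> (?l [^]\<^bsub>?P\<^esub> m)"
      using Suc.prems g' l lm by (simp add: P.m_ac)
    then have "f \<otimes>\<^bsub>?P\<^esub> g' = ?l [^]\<^bsub>?P\<^esub> m"
      using P.m_lcancel[of ?l] l lm g' Suc.prems by (simp add: univ_poly_zero)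
    from Suc.IH[OF Suc.prems(1) g'(1) this] show ?thesis .
  qed
qed

lemma (in ring) minus_nat_pow_mem_iff:
  assumes M: "subring M R" and x: "x \<in> carrier R"
  shows "(\<ominus> x) [^] (n::nat) \<in> M \<longleftrightarrow> x [^] n \<in> M"
proof -
  have "(\<ominus> x) [^] n = x [^] n \<or> (\<ominus> x) [^] n = \<ominus> (x [^] n)"
    using x by (induction n) (auto simp: l_minus r_minus)
  then show ?thesis
    using subringE(5)[OF M] x by (metis minus_minus nat_pow_closed)
qed

lemma (in field) subfield_mem_of_coprime_powers:
  assumes M: "subfield M R" and x: "x \<in> carrier R"
    and "x [^] (a::nat) \<in> M" "x [^] (b::nat) \<in> M" "coprime a b" "a \<noteq> 0"
  shows "x \<in> M"
proof (cases "x = \<zero>")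
  case True
  then show ?thesis
    using subringE(2)[OF subfieldE(1)[OF M]] by simp
next
  case False
  have pow: "y [^] (n::nat) \<in> M" if "y \<in> M" for y n
    using subringE(3,6)[OF subfieldE(1)[OF M]] that by (induction n) auto
  obtain u v where uv: "a * u = Suc (b * v)"
    using bezout_nat[of a b] assms(5,6) by auto
  have "x [^] n \<noteq> \<zero>" for n :: nat
    using x False by (induction n) (auto simp: integral_iff)
  then have nz: "x [^] (b * v) \<in> M - {\<zero>}"
    using pow[OF assms(4), of v] x by (simp add: nat_pow_pow)
  have "x [^] (b * v) \<otimes> x = (x [^] a) [^] u"
    using x by (simp add: nat_pow_pow uv)
  then have "x [^] (b * v) \<otimes> x \<in> M"
    using pow[OF assms(3)] by simp
  then show ?thesis
    using subfield_m_inv_simprule[OF M nz x] by blast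
qed

locale char_p_field = field +
  fixes p :: nat
  assumes prime_p: "Factorial_Ring.prime p" and p_one: "[p] \<cdot> \<one> = \<zero>"
begin

text \<open>
  This is \<open>(X - x)\<^sup>p = X\<^sup>p - x\<^sup>p\<close>, whose right-hand side has its coefficients in \<open>M\<close>.
\<close>

lemma linear_pow_p:
  assumes x: "x \<in> carrier R" "x \<noteq> \<zero>" and M: "subring M R" "x [^] p \<in> M"
  shows "[\<one>, \<ominus> x] [^]\<^bsub>poly_ring R\<^esub> p \<in> carrier (M[X])"
proof -
  let ?P = "poly_ring R"
  interpret P: domain ?P
    by (rule univ_poly_is_domain[OF carrier_is_subring])
  interpret N: ring "M[X]"
    by (rule univ_poly_is_ring[OF M(1)])
  interpret C: ring_hom_ring R ?P poly_of_const
    using canonical_embedding_ring_hom[OF carrier_is_subring] by simp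
  have "[p] \<cdot>\<^bsub>?P\<^esub> \<one>\<^bsub>?P\<^esub> = \<zero>\<^bsub>?P\<^esub>"
  proof -
    have "poly_of_const ([k] \<cdot> \<one>) = [k] \<cdot>\<^bsub>?P\<^esub> \<one>\<^bsub>?P\<^esub>" for k :: nat
      by (induction k) auto
    from this[of p] show ?thesis
      using p_one by simp
  qed
  note frob = P.frobenius_add[OF prime_p this]
  have X: "X \<in> carrier ?P" and c: "poly_of_const (\<ominus> x) \<in> carrier ?P"
    using var_closed(1)[OF carrier_is_subring] x by auto
  have "[\<one>, \<ominus> x] = X \<oplus>\<^bsub>?P\<^esub> poly_of_const (\<ominus> x)"
    using x by (simp add: univ_poly_add poly_of_const_def var_def)
  then have "[\<one>, \<ominus> x] [^]\<^bsub>?P\<^esub> p = X [^]\<^bsub>?P\<^esub> p \<oplus>\<^bsub>?P\<^esub> poly_of_const (\<ominus> x) [^]\<^bsub>?P\<^esub> p"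
    using frob[OF X c] by simp
  also have "poly_of_const (\<ominus> x) [^]\<^bsub>?P\<^esub> p = poly_of_const ((\<ominus> x) [^] p)"
    using C.hom_nat_pow[of "\<ominus> x" p] x by simp
  also have "X [^]\<^bsub>?P\<^esub> p = X [^]\<^bsub>M[X]\<^esub> p"
    by (simp add: nat_pow_def univ_poly_mult univ_poly_one)
  finally have eq: "[\<one>, \<ominus> x] [^]\<^bsub>?P\<^esub> p = X [^]\<^bsub>M[X]\<^esub> p \<oplus>\<^bsub>M[X]\<^esub> poly_of_const ((\<ominus> x) [^] p)"
    by (simp add: univ_poly_add)
  have "(\<ominus> x) [^] p \<in> M"
    using M(2) minus_nat_pow_mem_iff[OF M(1) x(1)] by simp
  then have "poly_of_const ((\<ominus> x) [^] p) \<in> carrier (M[X])"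
    by (auto simp: poly_of_const_def univ_poly_carrier[symmetric] polynomial_def)
  then show ?thesis
    unfolding eq using var_pow_closed[OF M(1)] by simp
qed

text \<open>
  The minimal polynomial \<open>f\<close> of \<open>x\<close> over \<open>M\<close> divides \<open>(X - x)\<^sup>p\<close>, so \<open>f = (X - x)\<^sup>i\<close> with \<open>0 < i \<le> p\<close>. Its
  constant term shows \<open>x\<^sup>i \<in> M\<close>; since also \<open>x\<^sup>p \<in> M\<close> but \<open>x \<notin> M\<close>, the exponents \<open>i\<close> and
  \<open>p\<close> are not coprime, which leaves \<open>i = p\<close>.
\<close>

lemma dimension_adjoin_pth_root:
  assumes M: "subfield M R" and x: "x \<in> carrier R" "x \<notin> M" and xp: "x [^] p \<in> M"
  shows "dimension p M (generate_field R (insert x M))"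
proof -
  let ?P = "poly_ring R" and ?l = "[\<one>, \<ominus> x]" and ?f = "Irr M x"
  note Mr = subfieldE(1)[OF M]
  interpret P: domain ?P
    by (rule univ_poly_is_domain[OF carrier_is_subring])
  interpret E: ring_hom_ring ?P R "\<lambda>q. eval q x"
    by (rule eval_ring_hom[OF carrier_is_subring x(1)])
  interpret E0: ring_hom_ring ?P R "\<lambda>q. eval q \<zero>"
    by (rule eval_ring_hom[OF carrier_is_subring zero_closed])
  have x0: "x \<noteq> \<zero>"
    using x(2) subringE(2)[OF Mr] by auto
  have l: "?l \<in> carrier ?P"
    using x by (simp add: univ_poly_carrier[symmetric] polynomial_def)
  have lp: "?l [^]\<^bsub>?P\<^esub> p \<in> carrier (M[X])"
    by (rule linear_pow_p[OF x(1) x0 Mr xp])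
  have "eval (?l [^]\<^bsub>?P\<^esub> p) x = \<zero>"
    using E.hom_nat_pow[OF l, of p] x prime_gt_0_nat[OF prime_p] by (simp add: r_neg nat_pow_zero)
  moreover have ne: "?l [^]\<^bsub>?P\<^esub> p \<noteq> []"
    by (rule polynomial_pow_not_zero[OF l]) simp
  ultimately have alg: "(algebraic over M) x"
    and dvd: "?f pdivides (?l [^]\<^bsub>?P\<^esub> p)"
    using algebraicI[OF lp] Irr_minimal[OF M x(1) _ lp] unfolding over_def by auto
  note f = IrrE[OF M x(1) alg]
  have fR: "?f \<in> carrier ?P"
    using carrier_polynomial_shell[OF Mr f(1)] .
  have "degree ?f \<le> degree (?l [^]\<^bsub>?P\<^esub> p)"
    using pdivides_imp_degree_le[OF Mr f(1) lp ne dvd] .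
  then have le: "degree ?f \<le> p"
    using polynomial_pow_degree[OF l, of p] by simp
  have deg0: "degree ?f \<ge> 1"
    by (rule pirreducible_degree[OF M f(1,2)])
  obtain g where "g \<in> carrier ?P" "?f \<otimes>\<^bsub>?P\<^esub> g = ?l [^]\<^bsub>?P\<^esub> p"
    using dvd unfolding pdivides_def factor_def by metis
  from linear_power_factor[OF x(1) fR this]
  obtain u i where u: "u \<in> Units ?P" and fu: "?f = u \<otimes>\<^bsub>?P\<^esub> (?l [^]\<^bsub>?P\<^esub> (i::nat))"
    by blast
  obtain c where c: "u = [c]" "c \<in> carrier R" "c \<noteq> \<zero>"
    using u univ_poly_carrier_units by auto
  have uc: "u \<in> carrier ?P"
    using u by (simp add: P.Units_closed)
  have li: "?l [^]\<^bsub>?P\<^esub> i \<in> carrier ?P" "?l [^]\<^bsub>?P\<^esub> i \<noteq> []"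
    using l polynomial_pow_not_zero[OF l] by simp_all
  have lead: "lead_coeff (?l [^]\<^bsub>?P\<^esub> (k::nat)) = \<one>" for k
  proof (induction k)
    case 0
    show ?case by (simp add: univ_poly_one)
  next
    case (Suc k)
    have "lead_coeff (?l [^]\<^bsub>?P\<^esub> k \<otimes>\<^bsub>?P\<^esub> ?l) = lead_coeff (?l [^]\<^bsub>?P\<^esub> k) \<otimes> lead_coeff ?l"
      unfolding univ_poly_mult
      by (rule poly_mult_lead_coeff[OF carrier_is_subring])
        (use l polynomial_pow_not_zero[OF l, of k] in \<open>simp_all add: univ_poly_carrier\<close>)
    then show ?case using Suc by simp
  qed
  have "lead_coeff ?f = c \<otimes> \<one>"
    unfolding fu univ_poly_mult
    by (subst poly_mult_lead_coeff[OF carrier_is_subring])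
      (use uc li c lead in \<open>simp_all add: univ_poly_carrier\<close>)
  then have c1: "c = \<one>"
    using f(3) c by simp
  then have fl: "?f = ?l [^]\<^bsub>?P\<^esub> i"
    using fu c li(1) P.l_one[OF li(1)] unfolding univ_poly_one by simp
  have di: "degree ?f = i"
    using polynomial_pow_degree[OF l, of i] fl by simp
  \<comment> \<open>The constant term of \<open>f\<close> is its value at \<open>0\<close>.\<close>
  have "eval ?f \<zero> = (\<ominus> x) [^] i"
    using E0.hom_nat_pow[OF l, of i] x fl by simp
  moreover have "eval ?f \<zero> \<in> M"
    using ring.eval_in_carrier[OF subring_is_ring[OF Mr], of ?f \<zero>] f(1) subringE(2)[OF Mr]
      polynomial_incl[of M ?f] by (simp add: eval_consistent[OF Mr] univ_poly_carrier)
  ultimately have "x [^] i \<in> M"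
    using minus_nat_pow_mem_iff[OF Mr x(1)] by simp
  have "i = p"
  proof (rule ccontr)
    assume "i \<noteq> p"
    with le di have "i < p" by simp
    then have "coprime i p"
      using prime_p deg0 di by (metis One_nat_def Suc_le_eq coprime_commute nat_dvd_not_less prime_imp_coprime_nat)
    then have "x \<in> M"
      using subfield_mem_of_coprime_powers[OF M x(1) \<open>x [^] i \<in> M\<close> xp] deg0 di by simp
    with x(2) show False ..
  qed
  then have dim: "dimension p M (simple_extension M x)"
    using dimension_simple_extension[OF M x(1) alg] di by simp
  have "simple_extension M x = generate_field R (insert x M)"
  proof (rule generate_fieldI)
    show "insert x M \<subseteq> carrier R"
      using x subfieldE(3)[OF M] by simp
    show "subfield (simple_extension M x) R"
      using simple_extension_is_subfield[OF M x(1)] alg by simp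
    show "insert x M \<subseteq> simple_extension M x"
      using simple_extension_mem[OF Mr x(1)] simple_extension_incl[OF subfieldE(3)[OF M] x(1)] by simp
    show "simple_extension M x \<subseteq> K" if "subfield K R" "insert x M \<subseteq> K" for K
      using simple_extension_subring_incl[OF subfieldE(1)[OF that(1)]] that(2) by simp
  qed
  with dim show ?thesis by simp
qed

end

section \<open>Degrees over the fields of \<open>p\<close>-power elements\<close>

lemma hom_image_generate_field:
  assumes "field R" "field S" and h: "ring_hom_ring R S h" and H: "H \<subseteq> carrier R"
  shows "h ` generate_field R H = generate_field S (h ` H)"
proof
  interpret R: field R by fact
  interpret S: field S by fact
  interpret h: ring_hom_ring R S h by fact
  have hH: "h ` H \<subseteq> carrier S"
    using H by auto
  show "h ` generate_field R H \<subseteq> generate_field S (h ` H)"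
  proof clarify
    fix x assume "x \<in> generate_field R H"
    then show "h x \<in> generate_field S (h ` H)"
    proof induction
      case (m_inv x)
      then have x: "x \<in> Units R"
        using R.generate_field_in_carrier[OF H] R.field_Units by auto
      then have hx: "h x \<otimes>\<^bsub>S\<^esub> h (inv\<^bsub>R\<^esub> x) = \<one>\<^bsub>S\<^esub>"
        using h.hom_mult[of x "inv\<^bsub>R\<^esub> x"] by (simp add: R.Units_closed)
      then have "inv\<^bsub>S\<^esub> h x = h (inv\<^bsub>R\<^esub> x)"
        using x by (intro S.comm_inv_char) (simp_all add: R.Units_closed)
      moreover have "h x \<noteq> \<zero>\<^bsub>S\<^esub>"
        using hx x by (auto simp: R.Units_closed)
      ultimately show ?case
        using generate_field.m_inv[OF m_inv.IH] by simp
    qed (use R.generate_field_in_carrier[OF H] in \<open>auto intro: generate_field.intros\<close>)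
  qed
  have "subfield (h ` generate_field R H) S"
    using h.img_is_subfield(2)[OF R.generate_field_is_subfield[OF H]] by simp
  then show "generate_field S (h ` H) \<subseteq> h ` generate_field R H"
    by (rule S.generate_field_min_subfield1[OF hH]) (auto intro: generate_field.incl)
qed

context field
begin

lemma generate_field_of_subfield:
  assumes "subfield M R"
  shows "generate_field R M = M"
  using generate_fieldI[OF subfieldE(3)[OF assms] assms] by simp

lemma generate_field_Un_generate_field:
  assumes "A \<subseteq> carrier R" "B \<subseteq> carrier R"
  shows "generate_field R (generate_field R A \<union> B) = generate_field R (A \<union> B)"
proof (rule generate_fieldI[symmetric])
  show "generate_field R A \<union> B \<subseteq> carrier R"
    using assms generate_field_incl by auto
  show "subfield (generate_field R (A \<union> B)) R"
    using assms by (intro generate_field_is_subfield) auto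
  show "generate_field R A \<union> B \<subseteq> generate_field R (A \<union> B)"
    using mono_generate_field[of A "A \<union> B"] assms by (auto intro: generate_field.incl)
  show "generate_field R (A \<union> B) \<subseteq> K" if "subfield K R" "generate_field R A \<union> B \<subseteq> K" for K
    using that assms by (intro generate_field_min_subfield1) (auto intro: generate_field.incl)
qed

lemma dimension_mono:
  assumes K: "subfield K R" and "dimension m K E" "dimension n K F" "E \<subseteq> F"
  shows "m \<le> n"
proof -
  obtain Us where "set Us \<subseteq> carrier R" "independent K Us" "length Us = m" "Span K Us = E"
    using exists_base[OF K assms(2)] by blast
  then show ?thesis
    using independent_length_le_dimension[OF K assms(3), of Us] Span_base_incl[OF K, of Us] assms(4)
    by auto
qed

end

context char_p_field
begin

lemma frobenius_hom: "ring_hom_ring R R (\<lambda>x. x [^] (p ^ n))"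
proof (rule ring_hom_ringI2[OF ring_axioms ring_axioms], rule ring_hom_memI)
  have pow: "x [^] (p ^ Suc n) = (x [^] (p ^ n)) [^] p" if "x \<in> carrier R" for x n
    using that by (simp add: nat_pow_pow mult.commute)
  show "(x \<oplus> y) [^] (p ^ n) = x [^] (p ^ n) \<oplus> y [^] (p ^ n)"
    if "x \<in> carrier R" "y \<in> carrier R" for x y
  proof (induction n)
    case (Suc n)
    then show ?case
      using that frobenius_add[OF prime_p p_one] by (simp add: pow del: power_Suc)
  qed (use that in simp)
qed (auto simp: nat_pow_distrib)

lemma frobenius_inj: "inj_on (\<lambda>x. x [^] (p ^ n)) (carrier R)"
proof -
  interpret h: ring_hom_ring R R "\<lambda>x. x [^] (p ^ n)" by (rule frobenius_hom)
  show ?thesis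
    using h.img_is_subfield(1)[OF carrier_is_subfield] by simp
qed

definition level :: "nat \<Rightarrow> 'a set"
  where "level n = (\<lambda>x. x [^] (p ^ n)) ` carrier R"

lemma subfield_level: "subfield (level n) R"
proof -
  interpret h: ring_hom_ring R R "\<lambda>x. x [^] (p ^ n)" by (rule frobenius_hom)
  show ?thesis
    using h.img_is_subfield(2)[OF carrier_is_subfield] by (simp add: level_def)
qed

lemma level_in_carrier: "level n \<subseteq> carrier R"
  by (rule subfieldE(3)[OF subfield_level])

lemma level_0: "level 0 = carrier R"
  by (auto simp: level_def)

lemma frobenius_image_level: "(\<lambda>x. x [^] (p ^ n)) ` level m = level (m + n)"
  unfolding level_def image_image by (intro image_cong) (simp_all add: nat_pow_pow power_add)

lemma frobenius_image_generate_field: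
  assumes "S \<subseteq> carrier R"
  shows "(\<lambda>x. x [^] (p ^ n)) ` generate_field R (level m \<union> S)
    = generate_field R (level (m + n) \<union> (\<lambda>x. x [^] (p ^ n)) ` S)"
  using hom_image_generate_field[OF field_axioms field_axioms frobenius_hom, of "level m \<union> S" n]
    assms level_in_carrier by (simp add: image_Un frobenius_image_level)

lemma frobenius_image_dimension:
  assumes "subfield K R" "dimension d K E" "E \<subseteq> carrier R"
  shows "dimension d ((\<lambda>x. x [^] (p ^ n)) ` K) ((\<lambda>x. x [^] (p ^ n)) ` E)"
proof -
  interpret h: ring_hom_ring R R "\<lambda>x. x [^] (p ^ n)" by (rule frobenius_hom)
  show ?thesis
    by (rule h.inj_hom_dimension[OF assms(1) _ _ assms(2)])
      (use inj_on_subset[OF frobenius_inj assms(3)] in simp_all)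
qed

text \<open>
  Adjoining the elements of \<open>S\<close> one after the other, each step has degree \<open>p\<close> or \<open>1\<close>. A step
  of degree \<open>1\<close> would place an element in the field generated by the others, so independence
  forces all steps to have degree \<open>p\<close>.
\<close>

lemma dimension_adjoin_pth_roots:
  assumes M: "subfield M R" and "finite S" "S \<subseteq> carrier R" "\<And>x. x \<in> S \<Longrightarrow> x [^] p \<in> M"
  shows "\<exists>e\<le>card S. dimension (p ^ e) M (generate_field R (M \<union> S)) \<and>
    ((\<forall>x\<in>S. x \<notin> generate_field R (M \<union> (S - {x}))) \<longrightarrow> e = card S)"
  using assms(2-4)
proof (induction S rule: finite_induct)
  case empty
  show ?case
    using dimension_one[OF M] generate_field_of_subfield[OF M] by simp
next
  case (insert x S)
  let ?N = "generate_field R (M \<union> S)"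
  obtain e where e: "e \<le> card S" "dimension (p ^ e) M ?N"
    and indep: "(\<forall>x\<in>S. x \<notin> generate_field R (M \<union> (S - {x}))) \<Longrightarrow> e = card S"
    using insert by auto
  have MS: "M \<union> S \<subseteq> carrier R"
    using insert.prems subfieldE(3)[OF M] by simp
  then have N: "subfield ?N R"
    by (rule generate_field_is_subfield)
  have gen: "generate_field R (M \<union> insert x S) = generate_field R (insert x ?N)"
    using generate_field_Un_generate_field[of "M \<union> S" "{x}"] MS insert.prems by simp
  show ?case
  proof (cases "x \<in> ?N")
    case True
    then have "generate_field R (M \<union> insert x S) = ?N"
      unfolding gen by (simp add: insert_absorb generate_field_of_subfield[OF N])
    moreover have "insert x S - {x} = S"
      using insert.hyps by auto
    ultimately show ?thesis
      using e True insert.hyps by (intro exI[of _ e]) auto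
  next
    case False
    have "x [^] p \<in> ?N"
      using insert.prems by (auto intro: generate_field.incl)
    then have "dimension p ?N (generate_field R (M \<union> insert x S))"
      unfolding gen using dimension_adjoin_pth_root[OF N _ False] insert.prems by simp
    from telescopic_base[OF M N e(2) this]
    have "dimension (p ^ Suc e) M (generate_field R (M \<union> insert x S))"
      by (simp add: mult.commute)
    moreover have "e = card S" if "\<forall>y\<in>insert x S. y \<notin> generate_field R (M \<union> (insert x S - {y}))"
    proof (rule indep, intro ballI)
      fix y assume "y \<in> S"
      have "generate_field R (M \<union> (S - {y})) \<subseteq> generate_field R (M \<union> (insert x S - {y}))"
        by (rule mono_generate_field) (use MS insert.prems in auto)
      then show "y \<notin> generate_field R (M \<union> (S - {y}))"
        using that \<open>y \<in> S\<close> by auto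
    qed
    ultimately show ?thesis
      using e insert.hyps by (intro exI[of _ "Suc e"]) auto
  qed
qed

definition p_independent :: "'a set \<Rightarrow> bool"
  where "p_independent S \<longleftrightarrow> (\<forall>x\<in>S. x \<notin> generate_field R (level 1 \<union> (S - {x})))"

text \<open>
  Split the extension at the field generated by the \<open>p\<close>-th powers of \<open>S\<close>. The upper part is
  covered by \<open>dimension_adjoin_pth_roots\<close>. The lower part is the Frobenius image of the same
  extension for \<open>n - 1\<close>, so it has the degree given by induction. The upper bound will be
  applied to finite subsets of a \<open>p\<close>-base of \<open>k\<close>, the equality to those of an \<open>r\<close>-base.
\<close>

lemma dimension_adjoin_level:
  assumes S: "finite S" "S \<subseteq> carrier R"
  shows "\<exists>e\<le>n * card S. dimension (p ^ e) (level n) (generate_field R (level n \<union> S)) \<and>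
    (p_independent S \<longrightarrow> e = n * card S)"
proof (induction n)
  case 0
  have "generate_field R (level 0 \<union> S) = level 0"
    using S generate_field_of_subfield[OF carrier_is_subfield] by (simp add: level_0 Un_absorb2)
  then show ?case
    using dimension_one[OF subfield_level] by simp
next
  case (Suc n)
  let ?\<phi> = "\<lambda>x. x [^] (p ^ 1)" and ?L = "level (Suc n)"
  let ?G = "generate_field R (level n \<union> S)"
  let ?F = "generate_field R (?L \<union> ?\<phi> ` S)"
  obtain e where e: "e \<le> n * card S" "dimension (p ^ e) (level n) ?G"
    and indep: "p_independent S \<Longrightarrow> e = n * card S"
    using Suc by auto
  have G: "?G \<subseteq> carrier R"
    using S level_in_carrier by (intro generate_field_incl) auto
  have F_eq: "?F = ?\<phi> ` ?G"
    using frobenius_image_generate_field[OF S(2), of 1 n] by simp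
  have LS: "?L \<union> S \<subseteq> carrier R" "?L \<union> ?\<phi> ` S \<subseteq> carrier R"
    using level_in_carrier S by auto
  have F: "subfield ?F R"
    using LS by (intro generate_field_is_subfield)
  have dF: "dimension (p ^ e) ?L ?F"
    unfolding F_eq using frobenius_image_dimension[OF subfield_level e(2) G, of 1]
    by (simp only: frobenius_image_level Suc_eq_plus1)
  have "x [^] p \<in> ?F" if "x \<in> S" for x
    using that by (auto intro: generate_field.incl)
  from dimension_adjoin_pth_roots[OF F S this]
  obtain e' where e': "e' \<le> card S" "dimension (p ^ e') ?F (generate_field R (?F \<union> S))"
    and indep': "\<forall>x\<in>S. x \<notin> generate_field R (?F \<union> (S - {x})) \<Longrightarrow> e' = card S"
    by blast
  have "generate_field R (?F \<union> S) = generate_field R (?L \<union> S)"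
  proof -
    have GLS: "subfield (generate_field R (?L \<union> S)) R"
      using LS(1) by (rule generate_field_is_subfield)
    have pow: "y [^] k \<in> generate_field R (?L \<union> S)" if "y \<in> generate_field R (?L \<union> S)" for y and k :: nat
      using that by (induction k) (auto intro: generate_field.intros)
    have "generate_field R (?F \<union> S) = generate_field R (?L \<union> ?\<phi> ` S \<union> S)"
      using generate_field_Un_generate_field[OF LS(2) S(2)] .
    also have "\<dots> = generate_field R (?L \<union> S)"
    proof
      show "generate_field R (?L \<union> ?\<phi> ` S \<union> S) \<subseteq> generate_field R (?L \<union> S)"
        by (rule generate_field_min_subfield1[OF _ GLS])
          (use LS pow in \<open>auto intro: generate_field.incl\<close>)
      show "generate_field R (?L \<union> S) \<subseteq> generate_field R (?L \<union> ?\<phi> ` S \<union> S)"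
        by (rule mono_generate_field) (use LS in auto)
    qed
    finally show ?thesis .
  qed
  with telescopic_base[OF subfield_level F dF e'(2)]
  have "dimension (p ^ (e + e')) ?L (generate_field R (?L \<union> S))"
    by (simp add: power_add)
  moreover have "e + e' = Suc n * card S" if ind: "p_independent S"
  proof -
    have "x \<notin> generate_field R (?F \<union> (S - {x}))" if "x \<in> S" for x
    proof -
      have "?F \<subseteq> level 1"
        unfolding F_eq using G by (auto simp: level_def)
      then have "generate_field R (?F \<union> (S - {x})) \<subseteq> generate_field R (level 1 \<union> (S - {x}))"
        using S level_in_carrier by (intro mono_generate_field) auto
      then show ?thesis
        using ind that by (auto simp: p_independent_def)
    qed
    then show ?thesis
      using indep[OF ind] indep' by simp
  qed
  ultimately show ?case
    using e e' by (intro exI[of _ "e + e'"]) auto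
qed

text \<open>
  Adjoining \<open>S\<close> to \<open>level m\<close> gives an extension of degree \<open>p\<close> to the power \<open>m * card S\<close>; transporting it by the \<open>n\<close>-th Frobenius power gives a field
  over \<open>level (m + n)\<close> that sits inside one of degree at most \<open>p\<close> to the power
  \<open>(m + n) * card F\<close>. The shift \<open>n\<close> becomes negligible when \<open>m\<close> grows.
\<close>

lemma p_independent_card_bound:
  assumes S: "finite S" "S \<subseteq> carrier R" "p_independent S" and F: "finite F" "F \<subseteq> carrier R"
    and sub: "(\<lambda>x. x [^] (p ^ n)) ` S \<subseteq> generate_field R (level (m + n) \<union> F)"
  shows "m * card S \<le> (m + n) * card F"
proof -
  let ?\<phi> = "\<lambda>x. x [^] (p ^ n)"
  have "dimension (p ^ (m * card S)) (level m) (generate_field R (level m \<union> S))"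
    using dimension_adjoin_level[OF S(1,2), of m] S(3) by auto
  from frobenius_image_dimension[OF subfield_level this, of n]
  have dS: "dimension (p ^ (m * card S)) (level (m + n)) (generate_field R (level (m + n) \<union> ?\<phi> ` S))"
    using S(2) level_in_carrier generate_field_incl[of "level m \<union> S"]
    by (simp add: frobenius_image_level frobenius_image_generate_field)
  obtain e where e: "e \<le> (m + n) * card F"
    and dF: "dimension (p ^ e) (level (m + n)) (generate_field R (level (m + n) \<union> F))"
    using dimension_adjoin_level[OF F] by blast
  have "subfield (generate_field R (level (m + n) \<union> F)) R"
    using F level_in_carrier by (intro generate_field_is_subfield) auto
  then have "generate_field R (level (m + n) \<union> ?\<phi> ` S) \<subseteq> generate_field R (level (m + n) \<union> F)"
    by (rule generate_field_min_subfield1[rotated])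
      (use S F level_in_carrier sub in \<open>auto intro: generate_field.incl\<close>)
  from dimension_mono[OF subfield_level dS dF this]
  have "m * card S \<le> e"
    using prime_gt_1_nat[OF prime_p] by simp
  with e show ?thesis by simp
qed

end

section \<open>Existence of \<open>r\<close>-bases\<close>

lemma (in field) generate_field_finite_subset:
  assumes "M \<subseteq> carrier R" "S \<subseteq> carrier R" and z: "z \<in> generate_field R (M \<union> S)"
  shows "\<exists>F. finite F \<and> F \<subseteq> S \<and> z \<in> generate_field R (M \<union> F)"
proof -
  have two: "\<exists>F. finite F \<and> F \<subseteq> S \<and> a \<in> generate_field R (M \<union> F) \<and> b \<in> generate_field R (M \<union> F)"
    if "finite F" "F \<subseteq> S" "a \<in> generate_field R (M \<union> F)"
      and "finite G" "G \<subseteq> S" "b \<in> generate_field R (M \<union> G)" for a b F G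
    using that assms(1,2) mono_generate_field[of "M \<union> F" "M \<union> (F \<union> G)"]
      mono_generate_field[of "M \<union> G" "M \<union> (F \<union> G)"]
    by (intro exI[of _ "F \<union> G"]) blast
  from z show ?thesis
  proof induction
    case one
    then show ?case by (auto intro!: exI[of _ "{}"] generate_field.one)
  next
    case (incl h)
    then consider "h \<in> M" | "h \<in> S" by auto
    then show ?case
    proof cases
      case 1
      then show ?thesis by (auto intro!: exI[of _ "{}"] generate_field.incl)
    next
      case 2
      then show ?thesis by (auto intro!: exI[of _ "{h}"] generate_field.incl)
    qed
  next
    case (eng_add a b)
    then obtain F where "finite F" "F \<subseteq> S" "a \<in> generate_field R (M \<union> F)" "b \<in> generate_field R (M \<union> F)"
      using two[of _ a _ b] by metis
    then show ?case by (blast intro: generate_field.eng_add)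
  next
    case (eng_mult a b)
    then obtain F where "finite F" "F \<subseteq> S" "a \<in> generate_field R (M \<union> F)" "b \<in> generate_field R (M \<union> F)"
      using two[of _ a _ b] by metis
    then show ?case by (blast intro: generate_field.eng_mult)
  qed (blast intro: generate_field.intros)+
qed

lemma (in field) char_p_field_characteristic:
  assumes "characteristic R > 0"
  shows "char_p_field R (characteristic R)"
proof
  have ord: "[n] \<cdot> \<one> = \<zero> \<longleftrightarrow> characteristic R dvd n" for n :: nat
    using group.pow_eq_id[OF add.is_group, of \<one> n] by (simp add: characteristic_def add_pow_def)
  then show "[characteristic R] \<cdot> \<one> = \<zero>" by simp
  show "Factorial_Ring.prime (characteristic R)"
  proof (rule prime_natI)
    have "characteristic R \<noteq> 1"
      using ord[of 1] by auto
    with assms show "2 \<le> characteristic R" by simp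
  next
    fix a b :: nat
    assume "characteristic R dvd a * b"
    moreover have "[(a * b)] \<cdot> \<one> = ([a] \<cdot> \<one>) \<otimes> ([b] \<cdot> \<one>)"
      by (simp add: add_pow_ldistr add.nat_pow_pow mult.commute)
    ultimately have "([a] \<cdot> \<one>) \<otimes> ([b] \<cdot> \<one>) = \<zero>"
      by (simp flip: ord)
    then have "[a] \<cdot> \<one> = \<zero> \<or> [b] \<cdot> \<one> = \<zero>"
      by (rule integral) simp_all
    then show "characteristic R dvd a \<or> characteristic R dvd b"
      using ord by simp
  qed
qed

context char_p_field
begin

lemma characteristic_eq: "characteristic R = p"
proof -
  have ord: "[n] \<cdot> \<one> = \<zero> \<longleftrightarrow> characteristic R dvd n" for n :: nat
    using group.pow_eq_id[OF add.is_group, of \<one> n] by (simp add: characteristic_def add_pow_def)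
  have "characteristic R \<noteq> 1"
    using ord[of 1] by auto
  moreover have "characteristic R dvd p"
    using ord p_one by blast
  ultimately show ?thesis
    using prime_p by (metis One_nat_def prime_nat_iff)
qed

lemma pth_powers_eq_level: "pth_powers R = level 1"
  by (simp add: pth_powers_def level_def characteristic_eq)

lemma char_p_field_subfield:
  assumes "subfield L R"
  shows "char_p_field (R\<lparr>carrier := L\<rparr>) p"
  using subfield_iff(2)[OF assms] prime_p p_one
  by (simp add: char_p_field_def char_p_field_axioms_def add_pow_def nat_pow_def)

text \<open>
  Unless \<open>y \<in> M\<close>, both simple extensions have degree \<open>p\<close> over \<open>M\<close>, and one contains the
  other, so they coincide.
\<close>

lemma generate_field_exchange:
  assumes M: "subfield M R" and x: "x \<in> carrier R" "x [^] p \<in> M" "x \<notin> M"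
    and y: "y \<in> carrier R" "y [^] p \<in> M" and xy: "x \<in> generate_field R (insert y M)"
  shows "y \<in> generate_field R (insert x M)"
proof (cases "y \<in> M")
  case True
  then show ?thesis by (auto intro: generate_field.incl)
next
  case False
  let ?E = "generate_field R (insert x M)" and ?F = "generate_field R (insert y M)"
  have in_carrier: "insert x M \<subseteq> carrier R" "insert y M \<subseteq> carrier R"
    using subfieldE(3)[OF M] x y by auto
  have F: "subfield ?F R"
    using in_carrier(2) by (rule generate_field_is_subfield)
  have "?E \<subseteq> ?F"
    by (rule generate_field_min_subfield1[OF in_carrier(1) F])
      (use xy in \<open>auto intro: generate_field.incl\<close>)
  moreover have dE: "dimension p M ?E" and dF: "dimension p M ?F"
    using dimension_adjoin_pth_root[OF M] x y False by auto
  ultimately have "?F \<subseteq> ?E"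
  proof -
    obtain Us where Us: "independent M Us" "length Us = p" "Span M Us = ?E"
      using exists_base[OF M dE] by blast
    with \<open>?E \<subseteq> ?F\<close> have "set Us \<subseteq> ?F"
      using Span_base_incl[OF M, of Us] independent_in_carrier[of M Us] by auto
    then have "Span M Us = ?F"
      using independent_length_eq_dimension[OF M dF Us(1)] Us(2) by blast
    then show ?thesis
      using Us(3) by simp
  qed
  then show ?thesis
    by (auto intro: generate_field.incl)
qed

text \<open>
  A maximal independent set generates by the exchange property. Without existence the choice in
  \<open>r_base_card\<close> would be an arbitrary set, so this is needed both for the extension and for the
  base field.
\<close>

lemma ex_r_base:
  assumes k: "k \<subseteq> carrier R"
  shows "\<exists>B. r_base R k B"
proof -
  let ?M = "k \<union> level 1"
  have M: "?M \<subseteq> carrier R"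
    using k level_in_carrier by simp
  define I where "I = {B. B \<subseteq> carrier R \<and> (\<forall>x\<in>B. x \<notin> generate_field R (?M \<union> (B - {x})))}"
  \<comment> \<open>Membership in a generated field is witnessed by finitely many generators, so unions of chains stay independent.\<close>
  have "\<exists>B\<in>I. \<forall>B'\<in>I. B \<subseteq> B' \<longrightarrow> B' = B"
  proof (rule subset_Zorn_nonempty)
    show "I \<noteq> {}"
      by (auto simp: I_def intro: exI[of _ "{}"])
    fix \<C> assume C: "\<C> \<noteq> {}" "subset.chain I \<C>"
    then have CI: "\<C> \<subseteq> I" and total: "\<And>A B. A \<in> \<C> \<Longrightarrow> B \<in> \<C> \<Longrightarrow> A \<subseteq> B \<or> B \<subseteq> A"
      unfolding subset.chain_def by blast+
    have carr: "\<Union>\<C> \<subseteq> carrier R"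
      using CI by (auto simp: I_def)
    have "x \<notin> generate_field R (?M \<union> (\<Union>\<C> - {x}))" if "x \<in> \<Union>\<C>" for x
    proof
      assume "x \<in> generate_field R (?M \<union> (\<Union>\<C> - {x}))"
      then obtain F where F: "finite F" "F \<subseteq> \<Union>\<C> - {x}" "x \<in> generate_field R (?M \<union> F)"
        using generate_field_finite_subset[OF M, of "\<Union>\<C> - {x}" x] carr by blast
      have "finite (insert x F)" "insert x F \<subseteq> \<Union>\<C>"
        using F that by auto
      then obtain A where A: "A \<in> \<C>" "insert x F \<subseteq> A"
        using finite_subset_Union_chain[OF _ _ C(1), of "insert x F" I] C(2) by blast
      have "generate_field R (?M \<union> F) \<subseteq> generate_field R (?M \<union> (A - {x}))"
        by (rule mono_generate_field) (use A F M carr in auto)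
      then have "x \<in> generate_field R (?M \<union> (A - {x}))"
        using F(3) by blast
      then show False
        using A CI by (auto simp: I_def)
    qed
    then show "\<Union>\<C> \<in> I"
      using carr by (simp add: I_def)
  qed
  then obtain B where B: "B \<in> I" and max: "\<And>B'. B' \<in> I \<Longrightarrow> B \<subseteq> B' \<Longrightarrow> B' = B"
    by blast
  have B_carr: "B \<subseteq> carrier R" and B_ind: "\<And>x. x \<in> B \<Longrightarrow> x \<notin> generate_field R (?M \<union> (B - {x}))"
    using B by (auto simp: I_def)
  have "y \<in> generate_field R (?M \<union> B)" if y: "y \<in> carrier R" for y
  proof (rule ccontr)
    assume ny: "y \<notin> generate_field R (?M \<union> B)"
    then have "y \<notin> B"
      by (auto intro: generate_field.incl)
    have "x \<notin> generate_field R (?M \<union> (insert y B - {x}))" if "x \<in> insert y B" for x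
    proof (cases "x = y")
      case True
      then show ?thesis
        using ny \<open>y \<notin> B\<close> by simp
    next
      case False
      with that have "x \<in> B" by simp
      let ?N = "generate_field R (?M \<union> (B - {x}))"
      have N_carr: "?M \<union> (B - {x}) \<subseteq> carrier R"
        using M B_carr by auto
      then have N: "subfield ?N R"
        by (rule generate_field_is_subfield)
      have pN: "z [^] p \<in> ?N" if "z \<in> carrier R" for z
        using that by (intro generate_field.incl) (auto simp: level_def)
      have x: "x \<in> carrier R"
        using \<open>x \<in> B\<close> B_carr by auto
      have gen: "generate_field R (insert z ?N) = generate_field R (?M \<union> insert z (B - {x}))"
        if "z \<in> carrier R" for z
        using generate_field_Un_generate_field[OF N_carr, of "{z}"] that by simp
      show ?thesis
      proof
        assume "x \<in> generate_field R (?M \<union> (insert y B - {x}))"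
        then have "x \<in> generate_field R (insert y ?N)"
          using False gen[OF y] by (simp add: insert_Diff_if)
        from generate_field_exchange[OF N x pN[OF x] B_ind[OF \<open>x \<in> B\<close>] y pN[OF y] this]
        have "y \<in> generate_field R (?M \<union> insert x (B - {x}))"
          using gen[OF x] by simp
        then show False
          using ny \<open>x \<in> B\<close> by (simp add: insert_absorb)
      qed
    qed
    then have "insert y B \<in> I"
      using y B_carr by (simp add: I_def)
    from max[OF this] \<open>y \<notin> B\<close> show False by auto
  qed
  moreover have "generate_field R (?M \<union> B) \<subseteq> carrier R"
    using M B_carr by (intro generate_field_incl) auto
  ultimately have "carrier R = generate_field R (?M \<union> B)"
    by auto
  with B_carr B_ind have "r_base R k B"
    by (simp add: r_base_def pth_powers_eq_level)
  then show ?thesis ..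
qed

section \<open>Comparing the bases\<close>

text \<open>
  Iterating \<open>k = k\<^sup>p(C)\<close> expresses \<open>k\<close> through \<open>C\<close> over arbitrarily high \<open>p\<close>-powers.
\<close>

lemma subset_generate_field_level:
  assumes k: "k \<subseteq> carrier R" and C: "C \<subseteq> carrier R"
    and gen: "k = generate_field R ((\<lambda>x. x [^] p) ` k \<union> C)"
  shows "k \<subseteq> generate_field R (level m \<union> C)"
proof (induction m)
  case 0
  show ?case
    using k by (auto simp: level_0 intro: generate_field.incl)
next
  case (Suc m)
  let ?E = "generate_field R (level (Suc m) \<union> C)"
  have E_carr: "level (Suc m) \<union> C \<subseteq> carrier R"
    using level_in_carrier C by simp
  then have E: "subfield ?E R"
    by (rule generate_field_is_subfield)
  have pow: "y [^] i \<in> ?E" if "y \<in> ?E" for y and i :: nat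
    using that by (induction i) (auto intro: generate_field.intros)
  have "(\<lambda>x. x [^] p) ` k \<subseteq> (\<lambda>x. x [^] p) ` generate_field R (level m \<union> C)"
    using Suc by (rule image_mono)
  also have "\<dots> = generate_field R (level (Suc m) \<union> (\<lambda>x. x [^] p) ` C)"
    using frobenius_image_generate_field[OF C, of 1 m] by simp
  also have "\<dots> \<subseteq> ?E"
    by (rule generate_field_min_subfield1[OF _ E])
      (use level_in_carrier C in \<open>auto intro!: pow intro: generate_field.incl\<close>)
  finally have sub: "(\<lambda>x. x [^] p) ` k \<union> C \<subseteq> ?E"
    by (auto intro: generate_field.incl)
  have "(\<lambda>x. x [^] p) ` k \<union> C \<subseteq> carrier R"
    using k C by auto
  from generate_field_min_subfield1[OF this E sub] show ?case
    using gen by simp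
qed

text \<open>
  Every \<open>x \<in> B\<close> satisfies \<open>x [^] p ^ n \<in> k\<close>, hence lies, after raising to that power, in the field
  generated by \<open>C\<close> over \<open>level (m + n)\<close> for each \<open>m\<close>. If \<open>C\<close> is finite, a large \<open>m\<close> in
  \<open>p_independent_card_bound\<close> gives \<open>card B \<le> card C\<close>. If \<open>C\<close> is infinite, the case \<open>m = 1\<close>
  shows that only finitely many \<open>x\<close> belong to a given finite subset of \<open>C\<close>, and \<open>C\<close> has as
  many finite subsets as elements.
\<close>

lemma p_independent_ordLeq:
  assumes k: "k \<subseteq> carrier R" "level n \<subseteq> k" and B: "B \<subseteq> carrier R" "p_independent B"
    and C: "C \<subseteq> carrier R" and gen: "k = generate_field R ((\<lambda>x. x [^] p) ` k \<union> C)"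
  shows "|B| \<le>o |C|"
proof -
  have B_sub: "p_independent S" if "S \<subseteq> B" for S
  proof -
    have "generate_field R (level 1 \<union> (S - {x})) \<subseteq> generate_field R (level 1 \<union> (B - {x}))" for x
      by (rule mono_generate_field) (use that B level_in_carrier in auto)
    then show ?thesis
      using B(2) that unfolding p_independent_def by blast
  qed
  have B_pow: "x [^] (p ^ n) \<in> generate_field R (level m \<union> C)" if "x \<in> B" for x m
    using that B(1) k(2) subset_generate_field_level[OF k(1) C gen, of m] by (auto simp: level_def)
  show ?thesis
  proof (cases "finite C")
    case True
    \<comment> \<open>Any \<open>m > n * card C\<close> turns \<open>m * card S \<le> (m + n) * card C\<close> into \<open>card S \<le> card C\<close>.\<close>
    let ?m = "Suc (n * card C)"
    have "card S \<le> card C" if "S \<subseteq> B" "finite S" for S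
    proof -
      have "?m * card S \<le> (?m + n) * card C"
        by (rule p_independent_card_bound) (use that B B_sub C True B_pow in auto)
      also have "\<dots> < ?m * Suc (card C)"
        by (simp add: algebra_simps)
      finally have "card S < Suc (card C)"
        using mult_less_cancel1[of ?m "card S" "Suc (card C)"] by blast
      then show ?thesis by simp
    qed
    then have "finite B \<and> card B \<le> card C"
      by (rule finite_if_finite_subsets_card_bdd)
    then show ?thesis
      using True by (simp add: finite_card_of_iff_card2)
  next
    case False
    define A where "A F = {x \<in> B. x [^] (p ^ n) \<in> generate_field R (level (1 + n) \<union> F)}" for F
    have "finite (A F)" if "F \<in> Fpow C" for F
    proof -
      have "card S \<le> (1 + n) * card F" if S: "S \<subseteq> A F" "finite S" for S
      proof -
        have "1 * card S \<le> (1 + n) * card F"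
          by (rule p_independent_card_bound)
            (use S B B_sub[of S] C \<open>F \<in> Fpow C\<close> in \<open>auto simp: A_def Fpow_def\<close>)
        then show ?thesis by simp
      qed
      then show ?thesis
        using finite_if_finite_subsets_card_bdd by blast
    qed
    then have "\<forall>F\<in>Fpow C. |A F| \<le>o |C|"
      using False by (blast intro: ordLeq3_finite_infinite)
    moreover have "|Fpow C| \<le>o |C|"
      using False by (intro ordIso_imp_ordLeq card_of_Fpow_infinite)
    ultimately have "|\<Union>F\<in>Fpow C. A F| \<le>o |C|"
      using False by (intro card_of_UNION_ordLeq_infinite) auto
    moreover have "B \<subseteq> (\<Union>F\<in>Fpow C. A F)"
    proof
      fix x assume "x \<in> B"
      with generate_field_finite_subset[OF level_in_carrier C B_pow[OF this, of "1 + n"]]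
      show "x \<in> (\<Union>F\<in>Fpow C. A F)"
        by (auto simp: A_def Fpow_def)
    qed
    ultimately show ?thesis
      using ordLeq_transitive[OF card_of_mono1] by blast
  qed
qed

lemma subfield_root_level:
  assumes k: "subfield k R"
  shows "subfield (root_level R k n) R" "k \<subseteq> root_level R k n"
proof -
  interpret h: ring_hom_ring R R "\<lambda>x. x [^] (p ^ n)" by (rule frobenius_hom)
  note kr = subringE[OF subfieldE(1)[OF k]]
  have eq: "root_level R k n = {x \<in> carrier R. x [^] (p ^ n) \<in> k}"
    by (simp add: root_level_def characteristic_eq)
  show "subfield (root_level R k n) R"
    unfolding eq
  proof (intro subfieldI' subringI)
    fix x assume "x \<in> {x \<in> carrier R. x [^] (p ^ n) \<in> k} - {\<zero>}"
    then have x: "x \<in> carrier R" "x \<noteq> \<zero>" "x [^] (p ^ n) \<in> k"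
      by auto
    then have i: "inv x \<in> carrier R" "x \<otimes> inv x = \<one>"
      using field_Units by auto
    then have "x [^] (p ^ n) \<otimes> inv x [^] (p ^ n) = \<one>"
      using h.hom_mult[of x "inv x"] x by simp
    moreover from this have "x [^] (p ^ n) \<noteq> \<zero>"
      using i by auto
    ultimately have "inv x [^] (p ^ n) \<in> k"
      using subfield_m_inv_simprule[OF k, of "x [^] (p ^ n)" "inv x [^] (p ^ n)"] x i kr(3) by simp
    with i show "inv x \<in> {x \<in> carrier R. x [^] (p ^ n) \<in> k}" by simp
  qed (use kr h.hom_a_inv in auto)
  have "x [^] i \<in> k" if "x \<in> k" for x and i :: nat
    using that kr by (induction i) auto
  then show "k \<subseteq> root_level R k n"
    using kr(1) by (auto simp: eq)
qed

lemma r_base_card_root_level_le: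
  assumes k: "subfield k R"
  shows "r_base_card (R\<lparr>carrier := root_level R k n\<rparr>) k \<le>o imperfection_degree (R\<lparr>carrier := k\<rparr>)"
proof -
  define L where "L = R\<lparr>carrier := root_level R k n\<rparr>"
  interpret L: char_p_field L p
    unfolding L_def by (rule char_p_field_subfield[OF subfield_root_level(1)[OF k]])
  interpret k: char_p_field "R\<lparr>carrier := k\<rparr>" p
    by (rule char_p_field_subfield[OF k])
  have pow: "x [^]\<^bsub>L\<^esub> i = x [^] i" "x [^]\<^bsub>R\<lparr>carrier := k\<rparr>\<^esub> i = x [^] i" for x and i :: nat
    by (simp_all add: nat_pow_def L_def)
  have Lk: "L\<lparr>carrier := k\<rparr> = R\<lparr>carrier := k\<rparr>"
    by (simp add: L_def)
  have k_sub: "k \<subseteq> carrier L"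
    using subfield_root_level(2)[OF k] by (simp add: L_def)
  have kL: "subfield k L"
    by (rule L.subfield_iff(1)) (use k_sub k.field_axioms Lk in auto)
  let ?P = "pth_powers (R\<lparr>carrier := k\<rparr>)"
  define B where "B = (SOME B. r_base L k B)"
  define C where "C = (SOME C. r_base (R\<lparr>carrier := k\<rparr>) ?P C)"
  have B: "r_base L k B"
    unfolding B_def using someI_ex[OF L.ex_r_base[OF k_sub]] .
  have "?P \<subseteq> carrier (R\<lparr>carrier := k\<rparr>)"
    using k.level_in_carrier unfolding k.pth_powers_eq_level .
  then have C: "r_base (R\<lparr>carrier := k\<rparr>) ?P C"
    unfolding C_def using someI_ex[OF k.ex_r_base] by blast
  have P: "?P = (\<lambda>x. x [^]\<^bsub>L\<^esub> p) ` k"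
    by (simp add: pth_powers_def k.characteristic_eq pow)
  have Ck: "C \<subseteq> k" and "k = generate_field (R\<lparr>carrier := k\<rparr>) (?P \<union> C)"
    using C by (auto simp: r_base_def)
  moreover have "?P \<subseteq> k"
    using \<open>?P \<subseteq> carrier (R\<lparr>carrier := k\<rparr>)\<close> by simp
  ultimately have gen: "k = generate_field L ((\<lambda>x. x [^]\<^bsub>L\<^esub> p) ` k \<union> C)"
    using L.subfield_gen_equality[OF kL, of "?P \<union> C"] by (simp add: Lk P)
  have B_carr: "B \<subseteq> carrier L"
    and B_ind: "\<And>x. x \<in> B \<Longrightarrow> x \<notin> generate_field L (k \<union> L.level 1 \<union> (B - {x}))"
    using B by (auto simp: r_base_def L.pth_powers_eq_level)
  \<comment> \<open>Independence over \<open>k\<close> and the \<open>p\<close>-th powers is stronger than over the \<open>p\<close>-th powers alone.\<close>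
  have "L.p_independent B"
    unfolding L.p_independent_def
  proof
    fix x assume "x \<in> B"
    have "generate_field L (L.level 1 \<union> (B - {x})) \<subseteq> generate_field L (k \<union> L.level 1 \<union> (B - {x}))"
      by (rule L.mono_generate_field) (use k_sub B_carr L.level_in_carrier in auto)
    with B_ind[OF \<open>x \<in> B\<close>] show "x \<notin> generate_field L (L.level 1 \<union> (B - {x}))" by blast
  qed
  moreover have "L.level n \<subseteq> k"
    unfolding L.level_def pow by (auto simp: L_def root_level_def characteristic_eq)
  ultimately have "|B| \<le>o |C|"
    using L.p_independent_ordLeq[OF k_sub _ B_carr _ _ gen] Ck k_sub by blast
  then show ?thesis
    unfolding imperfection_degree_def r_base_card_def B_def C_def L_def .
qed

end

theorem mainTheorem3:
  fixes K :: "('a, 'b) ring_scheme" and k :: "'a set"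
  assumes "field K" and "characteristic K > 0"
    and "subfield k K" and "purely_inseparable K k"
  shows "irrationality_degree K k \<le>o imperfection_degree (K\<lparr>carrier := k\<rparr>)"
proof -
  interpret char_p_field K "characteristic K"
    by (rule field.char_p_field_characteristic[OF assms(1,2)])
  show ?thesis
    unfolding irrationality_degree_def
  proof (rule card_sup_least)
    show "Card_order (imperfection_degree (K\<lparr>carrier := k\<rparr>))"
      by (simp add: imperfection_degree_def r_base_card_def card_of_Card_order)
  qed (use r_base_card_root_level_le[OF assms(3)] in
      \<open>auto simp: r_base_card_def card_of_Card_order\<close>)
qed

end
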